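(* Let $n\ge 1$, $\delta\in(0,n]$ and $p\in(\delta/n,\infty)$. Then there exists a constant $c$, depending only on $n$, $\delta$ and $p$, such that $$\int_{\mathbb{R}^n}\big(\mathcal{M}^n f(x)\big)^p\,d\mathcal{H}^\delta_\infty\le c\int_{\mathbb{R}^n}|f(x)|^p\,d\mathcal{H}^\delta_\infty$$ for all functions $f:\mathbb{R}^n\to[-\infty,\infty]$ (not assumed to be Lebesgue measurable).
   Context: For $\delta\in(0,n]$ and any set $E\subset\mathbb{R}^n$, the $\delta$-dimensional Hausdorff content is $\mathcal{H}^\delta_\infty(E):=\inf\{\sum_{i} r_i^\delta : E\subset\bigcup_{i} B(x_i,r_i)\}$, the infimum being over all countable (or finite) collections of open balls covering $E$. For an arbitrary set $\Omega\subset\mathbb{R}^n$ and an arbitrary function $g:\Omega\to[0,\infty]$ (no measurability required), the integral with respect to $\mathcal{H}^\delta_\infty$ is the Choquet integral $\int_\Omega g\,d\mathcal{H}^\delta_\infty:=\int_0^\infty \mathcal{H}^\delta_\infty(\{x\in\Omega: g(x)>t\})\,dt$. The Hausdorff content centred maximal function of order $n$ of $f:\mathbb{R}^n\to[-\infty,\infty]$ is $$\mathcal{M}^n f(x):=\sup_{r>0}\frac{1}{\mathcal{H}^n_\infty(B(x,r))}\int_{B(x,r)}|f(y)|\,d\mathcal{H}^n_\infty(y),\qquad x\in\mathbb{R}^n,$$ where $B(x,r)$ is the open ball with centre $x$ and radius $r$. *)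

theory Defs
  imports "HOL-Analysis.Analysis"
begin

text \<open>
  A countable (possibly finite) collection of balls is indexed by a set \<open>I\<close> of natural numbers.
  Sums of \<^typ>\<open>ennreal\<close> values over \<open>I\<close> always exist, so \<open>infsum\<close> has no default value here.
\<close>

definition hausdorff_content :: "real \<Rightarrow> 'a::metric_space set \<Rightarrow> ennreal" where
  "hausdorff_content \<delta> E =
     Inf {(\<Sum>\<^sub>\<infinity>i\<in>I. ennreal (r i powr \<delta>)) | (I :: nat set) (x :: nat \<Rightarrow> 'a) (r :: nat \<Rightarrow> real).
            (\<forall>i\<in>I. r i > 0) \<and> E \<subseteq> (\<Union>i\<in>I. ball (x i) (r i))}"

text \<open>
  No measurability of \<open>g\<close> is needed: the integrand below is a decreasing function of \<open>t\<close>,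
  hence Borel.
\<close>

definition choquet_integral :: "real \<Rightarrow> 'a::metric_space set \<Rightarrow> ('a \<Rightarrow> ennreal) \<Rightarrow> ennreal" where
  "choquet_integral \<delta> \<Omega> g =
     (\<integral>\<^sup>+t\<in>{0<..}. hausdorff_content \<delta> {x\<in>\<Omega>. g x > ennreal t} \<partial>lborel)"

definition content_maximal :: "(real ^ 'n \<Rightarrow> ereal) \<Rightarrow> real ^ 'n \<Rightarrow> ennreal" where
  "content_maximal f x =
     (SUP r\<in>{0<..}. choquet_integral (real CARD('n)) (ball x r) (\<lambda>y. e2ennreal \<bar>f y\<bar>)
                      / hausdorff_content (real CARD('n)) (ball x r))"

text \<open>Real powers on \<open>[0,\<infinity>]\<close>, used only for exponents \<open>p > 0\<close>, where \<open>\<infinity>\<^sup>p = \<infinity>\<close>.\<close>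

definition ennreal_rpow :: "ennreal \<Rightarrow> real \<Rightarrow> ennreal" where
  "ennreal_rpow a p = (if a = \<infinity> then \<infinity> else ennreal (enn2real a powr p))"

end

theory Submission
  imports Defs
begin

text \<open>
  Write \<open>H\<close> for the \<open>\<delta>\<close>-dimensional content, \<open>q = \<delta> / n\<close> and \<open>g = |f|\<close>.  Everything rests on the weak-type
  estimate (\<open>content_maximal_weak_type\<close>): \<open>H {M f > 2t}\<close> is at most \<open>10^\<delta>\<close> times the sum over
  \<open>j \<ge> 0\<close> of \<open>2^(jq) H {g > 2^j t}\<close>, in which only the level sets of \<open>g\<close> above \<open>t\<close> occur.  Substituting \<open>2t = s^(1/p)\<close>
  and integrating over \<open>s\<close>, the \<open>j\<close>-th term contributes, by the scaling \<open>s \<mapsto> a s\<close>,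
  the integral of \<open>g^p\<close> times a factor proportional to \<open>2^(j(q - p))\<close>.
  These factors form a convergent geometric series because \<open>p > q\<close>.

  The content is not additive on disjoint balls, so the weak-type estimate cannot be
  read off from Vitali's covering lemma directly.  Instead the level sets are replaced by a measure.
  Choose nearly optimal covers of the sets \<open>{g > 2^j t}\<close> by balls of radii \<open>r\<close> and let \<open>\<nu>\<close> put the
  mass \<open>2^(jq) (2r)^\<delta>\<close> on the centre of each ball.  If \<open>\<nu> (B(x, R)) < R^\<delta>\<close> for all \<open>R > 0\<close>, then
  a covering ball that meets \<open>B(x, \<rho>)\<close> has radius less than \<open>\<rho>\<close>, hence its centre lies in \<open>B(x, 2\<rho>)\<close>;
  as \<open>n / \<delta> \<ge> 1\<close>, the \<open>n\<close>-dimensional contents of \<open>{g > 2^j t} \<inter> B(x, \<rho>)\<close> are then so small that the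
  mean of \<open>g\<close> over \<open>B(x, \<rho>)\<close> is at most \<open>2t\<close>.  So at each point with \<open>M f > 2t\<close> some ball satisfies
  \<open>\<nu> (B(x, R)) \<ge> R^\<delta>\<close>, and for the measure \<open>\<nu>\<close> Vitali's lemma does give the estimate
  (\<open>hausdorff_content_le_of_growth\<close>).
\<close>

section \<open>Hausdorff content\<close>

lemma infsum_ennreal_eq_suminf:
  fixes f :: "nat \<Rightarrow> ennreal"
  shows "(\<Sum>\<^sub>\<infinity>i\<in>I. f i) = (\<Sum>i. if i \<in> I then f i else 0)"
proof -
  have "(\<Sum>\<^sub>\<infinity>i\<in>I. f i) = (\<Sum>\<^sub>\<infinity>i\<in>UNIV. if i \<in> I then f i else 0)"
    by (rule infsum_cong_neutral) auto
  moreover have "((\<lambda>i. if i \<in> I then f i else 0) has_sum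
      (\<Sum>\<^sub>\<infinity>i\<in>UNIV. if i \<in> I then f i else 0)) UNIV"
    by (intro has_sum_infsum nonneg_summable_on_complete) auto
  ultimately show ?thesis
    by (metis has_sum_imp_sums sums_unique)
qed

lemma hausdorff_content_le_suminf:
  assumes "\<And>i. i \<in> I \<Longrightarrow> r i > 0" and "E \<subseteq> (\<Union>i\<in>I. ball (x i) (r i))"
  shows "hausdorff_content \<delta> E \<le> (\<Sum>i. if i \<in> I then ennreal (r i powr \<delta>) else 0)"
  unfolding hausdorff_content_def infsum_ennreal_eq_suminf[symmetric]
  by (rule Inf_lower) (use assms in blast)

lemma hausdorff_content_less_obtain:
  assumes "hausdorff_content \<delta> E < v"
  obtains I x r where "\<And>i. i \<in> I \<Longrightarrow> r i > 0" and "E \<subseteq> (\<Union>i\<in>I. ball (x i) (r i))"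
    and "(\<Sum>i. if i \<in> I then ennreal (r i powr \<delta>) else 0) < v"
  using assms unfolding hausdorff_content_def Inf_less_iff infsum_ennreal_eq_suminf[symmetric]
  by blast

lemma hausdorff_content_le_nn_integral:
  assumes K: "countable K" and r: "\<And>k. k \<in> K \<Longrightarrow> r k > 0"
    and E: "E \<subseteq> (\<Union>k\<in>K. ball (x k) (r k))"
  shows "hausdorff_content \<delta> E \<le> (\<integral>\<^sup>+k. ennreal (r k powr \<delta>) \<partial>count_space K)"
proof -
  define I where "I = to_nat_on K ` K"
  define e where "e = inv_into K (to_nat_on K)"
  have bij: "bij_betw e I K"
    unfolding e_def I_def using K by (intro bij_betw_inv_into inj_on_imp_bij_betw inj_on_to_nat_on)
  have "hausdorff_content \<delta> E \<le> (\<Sum>i. if i \<in> I then ennreal (r (e i) powr \<delta>) else 0)"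
  proof (rule hausdorff_content_le_suminf)
    show "r (e i) > 0" if "i \<in> I" for i
      using r bij that by (auto dest: bij_betwE)
    show "E \<subseteq> (\<Union>i\<in>I. ball (x (e i)) (r (e i)))"
      using E unfolding bij_betw_imp_surj_on[OF bij, symmetric] by simp
  qed
  also have "\<dots> = (\<integral>\<^sup>+i. ennreal (r (e i) powr \<delta>) * indicator I i \<partial>count_space UNIV)"
    by (subst nn_integral_count_space_nat) (auto intro!: suminf_cong)
  also have "\<dots> = (\<integral>\<^sup>+i. ennreal (r (e i) powr \<delta>) \<partial>count_space I)"
    by (rule nn_integral_count_space_indicator[symmetric]) simp
  also have "\<dots> = (\<integral>\<^sup>+k. ennreal (r k powr \<delta>) \<partial>count_space K)"
    by (rule nn_integral_bij_count_space[OF bij])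
  finally show ?thesis .
qed

lemma hausdorff_content_mono:
  assumes "E \<subseteq> F"
  shows "hausdorff_content \<delta> E \<le> hausdorff_content \<delta> F"
  unfolding hausdorff_content_def by (rule Inf_superset_mono) (use assms in blast)

lemma hausdorff_content_ball_le:
  assumes "r > 0"
  shows "hausdorff_content \<delta> (ball x r) \<le> ennreal (r powr \<delta>)"
  using hausdorff_content_le_nn_integral[of "{()}" "\<lambda>_. r" "ball x r" "\<lambda>_. x" \<delta>] assms
  by (simp add: nn_integral_count_space_finite)

text \<open>The lower bound compares Lebesgue measures of the ball and of a cover.\<close>

lemma hausdorff_content_ball_eq:
  fixes x :: "'a::euclidean_space"
  assumes r: "r > 0"
  shows "hausdorff_content (real DIM('a)) (ball x r) = ennreal (r powr real DIM('a))"
proof (rule antisym[OF hausdorff_content_ball_le[OF r]])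
  define u where "u = unit_ball_vol (real DIM('a))"
  have u: "u > 0" unfolding u_def by simp
  have vol: "emeasure lborel (ball y s) = ennreal u * ennreal (s powr real DIM('a))" if "s > 0" for y :: 'a and s
    using that u by (simp add: emeasure_ball u_def powr_realpow ennreal_mult)
  show "ennreal (r powr real DIM('a)) \<le> hausdorff_content (real DIM('a)) (ball x r)"
  proof (rule ccontr)
    assume "\<not> ?thesis"
    then have "hausdorff_content (real DIM('a)) (ball x r) < ennreal (r powr real DIM('a))"
      by simp
    then obtain I y s where s: "\<And>i. i \<in> I \<Longrightarrow> s i > 0"
      and cov: "ball x r \<subseteq> (\<Union>i\<in>I. ball (y i) (s i))"
      and less: "(\<Sum>i. if i \<in> I then ennreal (s i powr real DIM('a)) else 0)
        < ennreal (r powr real DIM('a))"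
      by (rule hausdorff_content_less_obtain) (rule that)
    define A where "A i = (if i \<in> I then ball (y i) (s i) else {})" for i
    have "ennreal u * ennreal (r powr real DIM('a)) = emeasure lborel (ball x r)"
      using vol[OF r] by simp
    also have "\<dots> \<le> emeasure lborel (\<Union>i. A i)"
      using cov by (intro emeasure_mono) (auto simp: A_def)
    also have "\<dots> \<le> (\<Sum>i. emeasure lborel (A i))"
      by (intro emeasure_subadditive_countably) (auto simp: A_def)
    also have "\<dots> = (\<Sum>i. ennreal u * (if i \<in> I then ennreal (s i powr real DIM('a)) else 0))"
      by (intro suminf_cong) (auto simp: A_def vol s)
    also have "\<dots> = ennreal u * (\<Sum>i. if i \<in> I then ennreal (s i powr real DIM('a)) else 0)"
      by simp
    also have "\<dots> < ennreal u * ennreal (r powr real DIM('a))"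
      using less u by (intro ennreal_mult_strict_left_mono) auto
    finally show False by simp
  qed
qed

text \<open>
  The weak-type inequality for the fractional maximal function of a finite Borel measure: each point
  of \<open>S\<close> is the centre of a ball of large mass.  Finiteness bounds the radii of these balls, as
  Vitali's covering lemma requires.
\<close>

lemma hausdorff_content_le_of_growth:
  fixes \<nu> :: "'a::euclidean_space measure"
  assumes sets: "sets \<nu> = sets borel" and fin: "emeasure \<nu> UNIV < \<infinity>" and \<delta>: "0 < \<delta>"
    and growth: "\<And>x. x \<in> S \<Longrightarrow> \<exists>\<rho>>0. ennreal (\<rho> powr \<delta>) \<le> emeasure \<nu> (ball x \<rho>)"
  shows "hausdorff_content \<delta> S \<le> ennreal (5 powr \<delta>) * emeasure \<nu> UNIV"
proof -
  obtain \<rho> where \<rho>: "\<And>x. x \<in> S \<Longrightarrow> \<rho> x > 0"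
    and \<rho>_le: "\<And>x. x \<in> S \<Longrightarrow> ennreal (\<rho> x powr \<delta>) \<le> emeasure \<nu> (ball x (\<rho> x))"
    using growth by metis
  define W where "W = enn2real (emeasure \<nu> UNIV)"
  have W: "emeasure \<nu> UNIV = ennreal W" "W \<ge> 0"
    using fin by (auto simp: W_def less_top)
  have bound: "\<rho> x \<le> W powr (1 / \<delta>)" if "x \<in> S" for x
  proof -
    have "ennreal (\<rho> x powr \<delta>) \<le> ennreal W"
      unfolding W(1)[symmetric] using \<rho>_le[OF that]
      by (rule order_trans) (intro emeasure_mono, auto simp: sets)
    then have "\<rho> x powr \<delta> \<le> W" using W(2) by simp
    then have "(\<rho> x powr \<delta>) powr (1 / \<delta>) \<le> W powr (1 / \<delta>)"
      using \<delta> by (intro powr_mono2) auto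
    then show ?thesis using \<delta> \<rho>[OF that] by (simp add: powr_powr)
  qed
  have S: "S \<subseteq> (\<Union>x\<in>S. ball x (\<rho> x))"
    using \<rho> by force
  have radii: "0 < \<rho> x \<and> \<rho> x \<le> W powr (1 / \<delta>)" if "x \<in> S" for x
    using \<rho> bound that by blast
  obtain C where C: "countable C" "C \<subseteq> S"
    and disj: "pairwise (\<lambda>x y. disjnt (ball x (\<rho> x)) (ball y (\<rho> y))) C"
    and cov: "S \<subseteq> (\<Union>x\<in>C. ball x (5 * \<rho> x))"
    by (rule Vitali_covering_lemma_balls[OF S radii]) (blast intro: that)+
  have "hausdorff_content \<delta> S \<le> (\<integral>\<^sup>+x. ennreal ((5 * \<rho> x) powr \<delta>) \<partial>count_space C)"
    by (rule hausdorff_content_le_nn_integral[OF C(1) _ cov]) (use \<rho> C(2) in auto)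
  also have "\<dots> \<le> (\<integral>\<^sup>+x. ennreal (5 powr \<delta>) * emeasure \<nu> (ball x (\<rho> x)) \<partial>count_space C)"
  proof (rule nn_integral_mono)
    fix x assume "x \<in> space (count_space C)"
    then have "x \<in> S" using C by auto
    then show "ennreal ((5 * \<rho> x) powr \<delta>) \<le> ennreal (5 powr \<delta>) * emeasure \<nu> (ball x (\<rho> x))"
      using \<rho>[of x] \<rho>_le[of x] by (auto simp: powr_mult ennreal_mult intro!: mult_left_mono)
  qed
  also have "\<dots> = ennreal (5 powr \<delta>) * (\<integral>\<^sup>+x. emeasure \<nu> (ball x (\<rho> x)) \<partial>count_space C)"
    by (simp add: nn_integral_cmult)
  also have "(\<integral>\<^sup>+x. emeasure \<nu> (ball x (\<rho> x)) \<partial>count_space C) = emeasure \<nu> (\<Union>x\<in>C. ball x (\<rho> x))"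
    by (rule emeasure_UN_countable[symmetric])
      (use C disj in \<open>auto simp: sets disjoint_family_on_def pairwise_def disjnt_def\<close>)
  also have "ennreal (5 powr \<delta>) * \<dots> \<le> ennreal (5 powr \<delta>) * emeasure \<nu> UNIV"
    by (intro mult_left_mono emeasure_mono) (auto simp: sets)
  finally show ?thesis .
qed

section \<open>Choquet integrals\<close>

lemma borel_measurable_antimono_ennreal:
  fixes h :: "real \<Rightarrow> ennreal"
  assumes "antimono h"
  shows "h \<in> borel_measurable borel"
proof (rule borel_measurableI_greater)
  fix a
  have "is_interval {t. a < h t}"
    unfolding is_interval_1 using assms by (auto dest: antimonoD intro: less_le_trans)
  then show "{t \<in> space borel. a < h t} \<in> sets borel"
    by (simp add: real_interval_borel_measurable)
qed

lemma antimono_superlevel_content: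
  "antimono (\<lambda>t. hausdorff_content \<delta> {x \<in> \<Omega>. ennreal t < g x})"
  by (intro antimonoI hausdorff_content_mono)
    (auto intro: le_less_trans[OF ennreal_leI])

lemma dyadic_interval:
  fixes s t :: real
  assumes "0 < t" "t < s"
  obtains j :: nat where "2 ^ j * t < s" "s \<le> 2 ^ Suc j * t"
proof -
  obtain n where n: "s / t < 2 ^ n"
    using real_arch_pow[of 2 "s / t"] by auto
  have ex: "\<exists>n. s \<le> 2 ^ n * t"
    using n assms by (intro exI[of _ n]) (simp add: field_simps)
  define k where "k = (LEAST n. s \<le> 2 ^ n * t)"
  have k: "s \<le> 2 ^ k * t" unfolding k_def using ex by (rule LeastI_ex)
  then obtain j where j: "k = Suc j" using assms by (cases k) auto
  have "\<not> s \<le> 2 ^ j * t" using not_less_Least[of j "\<lambda>n. s \<le> 2 ^ n * t"] j k_def by auto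
  with k j show ?thesis by (intro that[of j]) auto
qed

text \<open>
  Levels up to \<open>t\<close> are estimated by the content of the whole of \<open>\<Omega>\<close>, and the levels in
  \<open>(2^j t, 2^(j+1) t]\<close> by their lower end point.
\<close>

lemma choquet_integral_le_dyadic:
  assumes t: "t > 0"
  shows "choquet_integral \<delta> \<Omega> g \<le> ennreal t * hausdorff_content \<delta> \<Omega> +
    (\<Sum>j. ennreal (2 ^ j * t) * hausdorff_content \<delta> {x \<in> \<Omega>. ennreal (2 ^ j * t) < g x})"
proof -
  define h where "h s = hausdorff_content \<delta> {x \<in> \<Omega>. ennreal s < g x}" for s
  have anti: "antimono h" unfolding h_def by (rule antimono_superlevel_content)
  define I where "I j = {2 ^ j * t<..2 ^ Suc j * t}" for j :: nat
  have "choquet_integral \<delta> \<Omega> g = (\<integral>\<^sup>+s\<in>{0<..}. h s \<partial>lborel)"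
    unfolding choquet_integral_def h_def by simp
  also have "\<dots> \<le> (\<integral>\<^sup>+s. hausdorff_content \<delta> \<Omega> * indicator {0<..t} s +
      (\<Sum>j. h (2 ^ j * t) * indicator (I j) s) \<partial>lborel)"
  proof (rule nn_integral_mono)
    fix s
    show "h s * indicator {0<..} s \<le> hausdorff_content \<delta> \<Omega> * indicator {0<..t} s +
      (\<Sum>j. h (2 ^ j * t) * indicator (I j) s)"
    proof (cases "s > t")
      case True
      then obtain j where j: "s \<in> I j" using dyadic_interval[OF t True] unfolding I_def by auto
      have "h s \<le> h (2 ^ j * t)" using j by (intro antimonoD[OF anti]) (auto simp: I_def)
      also have "\<dots> = (\<Sum>i\<in>{j}. h (2 ^ i * t) * indicator (I i) s)" using j by simp
      also have "\<dots> \<le> (\<Sum>i. h (2 ^ i * t) * indicator (I i) s)"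
        by (rule sum_le_suminf) auto
      finally show ?thesis using True t by simp
    next
      case False
      then show ?thesis
        by (auto simp: h_def indicator_def intro!: add_increasing2 hausdorff_content_mono)
    qed
  qed
  also have "\<dots> = (\<integral>\<^sup>+s. hausdorff_content \<delta> \<Omega> * indicator {0<..t} s \<partial>lborel) +
      (\<Sum>j. \<integral>\<^sup>+s. h (2 ^ j * t) * indicator (I j) s \<partial>lborel)"
    by (subst nn_integral_add, simp, simp add: I_def, subst nn_integral_suminf) (auto simp: I_def)
  also have "\<dots> = ennreal t * hausdorff_content \<delta> \<Omega> + (\<Sum>j. ennreal (2 ^ j * t) * h (2 ^ j * t))"
  proof -
    have "(\<integral>\<^sup>+s. h (2 ^ j * t) * indicator (I j) s \<partial>lborel) = ennreal (2 ^ j * t) * h (2 ^ j * t)" for j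
      using t by (simp add: I_def nn_integral_cmult_indicator mult.commute)
    then show ?thesis using t by (simp add: nn_integral_cmult_indicator mult.commute)
  qed
  finally show ?thesis unfolding h_def .
qed

lemma nn_integral_scale_Ioi:
  fixes h :: "real \<Rightarrow> ennreal"
  assumes h[measurable]: "h \<in> borel_measurable borel" and a: "a > 0"
  shows "(\<integral>\<^sup>+s\<in>{0<..}. h (a * s) \<partial>lborel) = ennreal (1 / a) * (\<integral>\<^sup>+s\<in>{0<..}. h s \<partial>lborel)"
proof -
  have "(\<integral>\<^sup>+s\<in>{0<..}. h s \<partial>lborel) = ennreal \<bar>a\<bar> * (\<integral>\<^sup>+s. h (0 + a * s) * indicator {0<..} (0 + a * s) \<partial>lborel)"
    by (rule nn_integral_real_affine) (use a in auto)
  also have "(\<integral>\<^sup>+s. h (0 + a * s) * indicator {0<..} (0 + a * s) \<partial>lborel) = (\<integral>\<^sup>+s\<in>{0<..}. h (a * s) \<partial>lborel)"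
    using a by (intro nn_integral_cong) (auto simp: indicator_def zero_less_mult_iff)
  finally show ?thesis
    using a by (simp add: mult.assoc[symmetric] ennreal_mult[symmetric])
qed

lemma less_ennreal_rpow_iff:
  assumes p: "p > 0" and s: "s \<ge> 0"
  shows "ennreal s < ennreal_rpow a p \<longleftrightarrow> ennreal (s powr (1 / p)) < a"
proof (cases a)
  case (real b)
  have "s < b powr p \<longleftrightarrow> s powr (1 / p) < b"
  proof
    assume "s < b powr p"
    then have "s powr (1 / p) < (b powr p) powr (1 / p)" using p s by (intro powr_less_mono2) auto
    then show "s powr (1 / p) < b" using p real by (simp add: powr_powr)
  next
    assume "s powr (1 / p) < b"
    then have "(s powr (1 / p)) powr p < b powr p" using p s by (intro powr_less_mono2) auto
    then show "s < b powr p" using p s by (simp add: powr_powr)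
  qed
  then show ?thesis using real s by (simp add: ennreal_rpow_def ennreal_less_iff)
qed (simp add: ennreal_rpow_def)


section \<open>The weak-type estimate\<close>

text \<open>
  With \<open>a = 2^(j \<delta> / N) (r / \<rho>)^\<delta> \<le> 1\<close>, this is \<open>a^(N / \<delta>) \<le> a\<close> in disguise.  It turns the
  \<open>\<delta>\<close>-dimensional weight of a covering ball into its contribution to an \<open>N\<close>-dimensional content.
\<close>

lemma rescaled_powr_le:
  fixes \<delta> N \<rho> r :: real
  assumes \<delta>: "0 < \<delta>" "\<delta> \<le> N" and pos: "0 < r" "0 < \<rho>"
    and le: "2 powr (\<delta> / N * real j) * (2 * r) powr \<delta> \<le> (2 * \<rho>) powr \<delta>"
  shows "2 ^ j * r powr N
    \<le> \<rho> powr N / (2 * \<rho>) powr \<delta> * (2 powr (\<delta> / N * real j) * (2 * r) powr \<delta>)"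
proof -
  define a where "a = 2 powr (\<delta> / N * real j) * (r / \<rho>) powr \<delta>"
  have a: "a = 2 powr (\<delta> / N * real j) * (2 * r) powr \<delta> / (2 * \<rho>) powr \<delta>"
    using pos by (simp add: a_def powr_mult powr_divide)
  have "0 \<le> a" "a \<le> 1"
    using le pos by (auto simp: a)
  then have "a powr (N / \<delta>) \<le> a powr 1"
    using \<delta> by (intro powr_mono') auto
  moreover have "a powr (N / \<delta>) = 2 ^ j * (r / \<rho>) powr N"
    using \<delta> by (simp add: a_def powr_mult powr_powr powr_realpow)
  ultimately have "2 ^ j * (r / \<rho>) powr N \<le> a"
    using \<open>0 \<le> a\<close> by simp
  then have "\<rho> powr N * (2 ^ j * (r / \<rho>) powr N) \<le> \<rho> powr N * a"
    by (intro mult_left_mono) auto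
  then show ?thesis
    using pos by (simp add: a powr_divide field_simps)
qed

lemma content_maximal_gt_obtain:
  fixes f :: "real ^ 'n \<Rightarrow> ereal"
  assumes "0 \<le> s" and "ennreal s < content_maximal f x"
  obtains \<rho> where "\<rho> > 0" and "ennreal (s * \<rho> powr real CARD('n)) <
    choquet_integral (real CARD('n)) (ball x \<rho>) (\<lambda>y. e2ennreal \<bar>f y\<bar>)"
proof -
  obtain \<rho> where \<rho>: "\<rho> > 0" and less: "ennreal s <
      choquet_integral (real CARD('n)) (ball x \<rho>) (\<lambda>y. e2ennreal \<bar>f y\<bar>)
        / hausdorff_content (real CARD('n)) (ball x \<rho>)"
    using assms(2) unfolding content_maximal_def less_SUP_iff by auto
  have "hausdorff_content (real CARD('n)) (ball x \<rho>) = ennreal (\<rho> powr real CARD('n))"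
    using hausdorff_content_ball_eq[OF \<rho>, of x] by simp
  then have "ennreal (s * \<rho> powr real CARD('n)) <
      choquet_integral (real CARD('n)) (ball x \<rho>) (\<lambda>y. e2ennreal \<bar>f y\<bar>)"
    using less \<rho> assms(1) divide_le_posI_ennreal[of "ennreal (\<rho> powr real CARD('n))" _ "ennreal s"]
    by (fastforce simp: ennreal_mult not_le[symmetric] mult.commute)
  with \<rho> that show ?thesis by blast
qed

text \<open>
  The error \<open>e\<close> in the proof accounts for the covers being only nearly optimal.  The level \<open>j\<close> has
  the factor \<open>b j\<close> in the sum, so its cover may exceed the content by a share \<open>2^(-j-1)\<close> of the total
  error, divided by \<open>b j\<close>.
\<close>

lemma content_maximal_weak_type:
  fixes f :: "real ^ 'n \<Rightarrow> ereal"
  assumes \<delta>: "0 < \<delta>" "\<delta> \<le> real CARD('n)" and t: "0 < t"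
  shows "hausdorff_content \<delta> {x. ennreal (2 * t) < content_maximal f x}
    \<le> ennreal (10 powr \<delta>) * (\<Sum>j. ennreal (2 powr (\<delta> / real CARD('n) * real j))
        * hausdorff_content \<delta> {x. ennreal (2 ^ j * t) < e2ennreal \<bar>f x\<bar>})"
proof -
  define N where "N = real CARD('n)"
  define b where "b j = 2 powr (\<delta> / N * real j)" for j :: nat
  define E where "E j = {x. ennreal (2 ^ j * t) < e2ennreal \<bar>f x\<bar>}" for j :: nat
  define S where "S = {x. ennreal (2 * t) < content_maximal f x}"
  define T where "T = (\<Sum>j. ennreal (b j) * hausdorff_content \<delta> (E j))"
  have N: "0 < N" "\<delta> \<le> N" using \<delta> by (auto simp: N_def)
  have b: "b j \<ge> 1" for j
    using \<delta> N by (auto simp: b_def intro!: ge_one_powr_ge_zero)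
  have b0: "b j > 0" for j
    using b[of j] by linarith
  have "hausdorff_content \<delta> S \<le> ennreal (10 powr \<delta>) * T"
  proof (rule ennreal_le_epsilon)
    fix e :: real
    assume e: "0 < e" and fin: "ennreal (10 powr \<delta>) * T < top"
    have T: "T < top"
      using fin by (auto simp: ennreal_mult_less_top)
    have H: "hausdorff_content \<delta> (E j) < top" for j
    proof -
      have "ennreal (b j) * hausdorff_content \<delta> (E j) < top"
        using T unfolding T_def by (rule ennreal_suminf_lessD)
      then show ?thesis using b0[of j] by (auto simp: ennreal_mult_less_top)
    qed
    define e' where "e' = e / 10 powr \<delta>"
    have e': "e' > 0" using e by (simp add: e'_def)
    define covers where "covers j I y r \<longleftrightarrow> (\<forall>i\<in>I. r i > 0) \<and> E j \<subseteq> (\<Union>i\<in>I. ball (y i) (r i)) \<and>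
        (\<Sum>i. if i \<in> I then ennreal (r i powr \<delta>) else 0)
          < hausdorff_content \<delta> (E j) + ennreal (e' * (1 / 2) ^ Suc j / b j)"
      for j I r and y :: "nat \<Rightarrow> real ^ 'n"
    have "\<exists>I y r. covers j I y r" for j
    proof -
      have "0 < ennreal (e' * (1 / 2) ^ Suc j / b j)"
        using e' b0[of j] by simp
      then have "hausdorff_content \<delta> (E j)
          < hausdorff_content \<delta> (E j) + ennreal (e' * (1 / 2) ^ Suc j / b j)"
        using H[of j] ennreal_add_left_cancel_less[of "hausdorff_content \<delta> (E j)" 0] by simp
      then show ?thesis
        unfolding covers_def by (rule hausdorff_content_less_obtain) blast
    qed
    then obtain I y r where "\<And>j. covers j (I j) (y j) (r j)"
      by metis
    then have r: "\<And>i j. i \<in> I j \<Longrightarrow> r j i > 0"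
      and cov: "\<And>j. E j \<subseteq> (\<Union>i\<in>I j. ball (y j i) (r j i))"
      and sum: "\<And>j. (\<Sum>i. if i \<in> I j then ennreal (r j i powr \<delta>) else 0)
          < hausdorff_content \<delta> (E j) + ennreal (e' * (1 / 2) ^ Suc j / b j)"
      unfolding covers_def by blast+
    \<comment> \<open>The factor \<open>2\<close> gives any ball of radius \<open>2 * r j i\<close> containing the centre \<open>y j i\<close> at least
      the mass \<open>(2 * r j i) powr \<delta>\<close>, because \<open>b j \<ge> 1\<close>.\<close>
    define w where "w j i = (if i \<in> I j then ennreal (b j * (2 * r j i) powr \<delta>) else 0)" for j i
    define \<nu> where "\<nu> = distr (density (count_space UNIV) (\<lambda>(j, i). w j i)) borel (\<lambda>(j, i). y j i)"
    have sets_\<nu>: "sets \<nu> = sets borel" by (simp add: \<nu>_def)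
    have \<nu>: "emeasure \<nu> A = (\<Sum>j. \<Sum>i. w j i * indicator A (y j i))" if "A \<in> sets borel" for A
    proof -
      have "emeasure \<nu> A = (\<integral>\<^sup>+z. (case z of (j, i) \<Rightarrow> w j i) *
          indicator ((\<lambda>(j, i). y j i) -` A) z \<partial>count_space UNIV)"
        unfolding \<nu>_def using that by (subst emeasure_distr) (auto simp: emeasure_density)
      also have "\<dots> = (\<integral>\<^sup>+z. (case z of (j, i) \<Rightarrow> w j i * indicator A (y j i)) \<partial>count_space UNIV)"
        by (intro nn_integral_cong) (auto simp: indicator_def)
      also have "\<dots> = (\<integral>\<^sup>+j. \<integral>\<^sup>+i. w j i * indicator A (y j i) \<partial>count_space UNIV \<partial>count_space UNIV)"
        using nn_integral_fst_count_space[of "\<lambda>(j, i). w j i * indicator A (y j i)"] by simp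
      finally show ?thesis by (simp add: nn_integral_count_space_nat)
    qed
    have w_le: "w j i \<le> emeasure \<nu> A" if "A \<in> sets borel" "y j i \<in> A" for A j i
    proof -
      have "w j i = (\<Sum>k\<in>{i}. w j k * indicator A (y j k))" using that by simp
      also have "\<dots> \<le> (\<Sum>k. w j k * indicator A (y j k))" by (rule sum_le_suminf) auto
      also have "\<dots> = (\<Sum>l\<in>{j}. \<Sum>k. w l k * indicator A (y l k))" by simp
      also have "\<dots> \<le> (\<Sum>l. \<Sum>k. w l k * indicator A (y l k))" by (rule sum_le_suminf) auto
      finally show ?thesis using \<nu>[OF that(1)] by simp
    qed
    have total: "emeasure \<nu> UNIV \<le> ennreal (2 powr \<delta>) * (T + ennreal e')"
    proof -
      have row: "(\<Sum>i. w j i) \<le> ennreal (2 powr \<delta>) *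
          (ennreal (b j) * hausdorff_content \<delta> (E j) + ennreal (e' * (1 / 2) ^ Suc j))" for j
      proof -
        have "(\<Sum>i. w j i) = (\<Sum>i. ennreal (2 powr \<delta> * b j) *
            (if i \<in> I j then ennreal (r j i powr \<delta>) else 0))"
          using b0[of j] r[of _ j]
          by (intro suminf_cong) (auto simp: w_def ennreal_mult[symmetric] powr_mult mult_ac)
        also have "\<dots> = ennreal (2 powr \<delta> * b j) * (\<Sum>i. if i \<in> I j then ennreal (r j i powr \<delta>) else 0)"
          by simp
        also have "\<dots> \<le> ennreal (2 powr \<delta> * b j) *
            (hausdorff_content \<delta> (E j) + ennreal (e' * (1 / 2) ^ Suc j / b j))"
          using sum[of j] by (intro mult_left_mono) auto
        also have "\<dots> = ennreal (2 powr \<delta>) * (ennreal (b j) * hausdorff_content \<delta> (E j) +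
            ennreal (b j) * ennreal (e' * (1 / 2) ^ Suc j / b j))"
          using b0[of j] by (simp add: ennreal_mult distrib_left mult.assoc)
        also have "ennreal (b j) * ennreal (e' * (1 / 2) ^ Suc j / b j) = ennreal (e' * (1 / 2) ^ Suc j)"
          using b0[of j] e' by (simp add: ennreal_mult[symmetric])
        finally show ?thesis .
      qed
      have "emeasure \<nu> UNIV = (\<Sum>j. \<Sum>i. w j i)" using \<nu>[of UNIV] by simp
      also have "\<dots> \<le> (\<Sum>j. ennreal (2 powr \<delta>) *
          (ennreal (b j) * hausdorff_content \<delta> (E j) + ennreal (e' * (1 / 2) ^ Suc j)))"
        by (intro suminf_le row) auto
      also have "\<dots> = ennreal (2 powr \<delta>) * (T + (\<Sum>j. ennreal (e' * (1 / 2) ^ Suc j)))"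
        unfolding T_def by (simp add: suminf_add[symmetric])
      also have "(\<Sum>j. ennreal (e' * (1 / 2) ^ Suc j)) = ennreal e'"
        using sums_mult[OF power_half_series, of e'] e' by (intro suminf_ennreal_eq) auto
      finally show ?thesis .
    qed
    have "hausdorff_content \<delta> S \<le> ennreal (5 powr \<delta>) * emeasure \<nu> UNIV"
    proof (rule hausdorff_content_le_of_growth[OF sets_\<nu> _ \<delta>(1)])
      show "emeasure \<nu> UNIV < \<infinity>"
        by (rule le_less_trans[OF total]) (use T in \<open>simp add: ennreal_mult_less_top\<close>)
    next
      fix x assume "x \<in> S"
      then obtain \<rho> where \<rho>: "\<rho> > 0" and large: "ennreal (2 * t * \<rho> powr N) <
          choquet_integral N (ball x \<rho>) (\<lambda>y. e2ennreal \<bar>f y\<bar>)"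
        using content_maximal_gt_obtain[of "2 * t" f x] t unfolding S_def N_def by auto
      show "\<exists>R>0. ennreal (R powr \<delta>) \<le> emeasure \<nu> (ball x R)"
      proof (rule ccontr)
        assume "\<not> ?thesis"
        then have small: "emeasure \<nu> (ball x R) < ennreal (R powr \<delta>)" if "R > 0" for R
          using that by (meson not_le)
        \<comment> \<open>The constant for which \<open>K * (2 * \<rho>) powr \<delta> = t * \<rho> powr N\<close>.\<close>
        define K where "K = t * (\<rho> powr N / (2 * \<rho>) powr \<delta>)"
        have K: "K \<ge> 0" using t by (simp add: K_def)
        have row: "ennreal (2 ^ j * t) * hausdorff_content N {z \<in> ball x \<rho>. ennreal (2 ^ j * t) < e2ennreal \<bar>f z\<bar>}
            \<le> ennreal K * (\<Sum>i. w j i * indicator (ball x (2 * \<rho>)) (y j i))" for j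
        proof -
          define J where "J = {i \<in> I j. y j i \<in> ball x (2 * \<rho>)}"
          have "{z \<in> ball x \<rho>. ennreal (2 ^ j * t) < e2ennreal \<bar>f z\<bar>} \<subseteq> (\<Union>i\<in>J. ball (y j i) (r j i))"
          proof
            fix z assume z: "z \<in> {z \<in> ball x \<rho>. ennreal (2 ^ j * t) < e2ennreal \<bar>f z\<bar>}"
            then have "z \<in> E j" by (simp add: E_def)
            then obtain i where i: "i \<in> I j" "dist (y j i) z < r j i"
              using cov[of j] by auto
            have d: "dist x (y j i) < \<rho> + r j i"
              using z i dist_triangle[of x "y j i" z] by (simp add: dist_commute)
            \<comment> \<open>Otherwise the centre alone gives the ball of radius \<open>2 * r j i\<close> too much mass.\<close>
            have "r j i < \<rho>"
            proof (rule ccontr)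
              assume "\<not> r j i < \<rho>"
              then have "y j i \<in> ball x (2 * r j i)" using d by simp
              then have "w j i \<le> emeasure \<nu> (ball x (2 * r j i))" by (intro w_le) auto
              also have "\<dots> < ennreal ((2 * r j i) powr \<delta>)" using r[OF i(1)] by (intro small) simp
              also have "\<dots> \<le> w j i"
                using i mult_right_mono[OF b[of j], of "(2 * r j i) powr \<delta>"]
                by (simp add: w_def ennreal_leI)
              finally show False by simp
            qed
            then have "i \<in> J" using d i by (simp add: J_def)
            then show "z \<in> (\<Union>i\<in>J. ball (y j i) (r j i))" using i by auto
          qed
          then have "hausdorff_content N {z \<in> ball x \<rho>. ennreal (2 ^ j * t) < e2ennreal \<bar>f z\<bar>}
              \<le> (\<Sum>i. if i \<in> J then ennreal (r j i powr N) else 0)"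
            by (intro hausdorff_content_le_suminf) (auto simp: J_def r)
          then have "ennreal (2 ^ j * t) * hausdorff_content N {z \<in> ball x \<rho>. ennreal (2 ^ j * t) < e2ennreal \<bar>f z\<bar>}
              \<le> ennreal (2 ^ j * t) * (\<Sum>i. if i \<in> J then ennreal (r j i powr N) else 0)"
            by (intro mult_left_mono) auto
          also have "\<dots> = (\<Sum>i. ennreal (2 ^ j * t) * (if i \<in> J then ennreal (r j i powr N) else 0))"
            by simp
          also have "\<dots> \<le> (\<Sum>i. ennreal K * (w j i * indicator (ball x (2 * \<rho>)) (y j i)))"
          proof (rule suminf_le)
            fix i
            show "ennreal (2 ^ j * t) * (if i \<in> J then ennreal (r j i powr N) else 0)
              \<le> ennreal K * (w j i * indicator (ball x (2 * \<rho>)) (y j i))"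
            proof (cases "i \<in> J")
              case True
              then have i: "i \<in> I j" "y j i \<in> ball x (2 * \<rho>)" by (auto simp: J_def)
              have "w j i \<le> emeasure \<nu> (ball x (2 * \<rho>))" using i by (intro w_le) auto
              also have "\<dots> < ennreal ((2 * \<rho>) powr \<delta>)" using \<rho> by (intro small) simp
              finally have "b j * (2 * r j i) powr \<delta> \<le> (2 * \<rho>) powr \<delta>"
                using i b0[of j] by (simp add: w_def ennreal_less_iff)
              then have "2 ^ j * r j i powr N \<le> \<rho> powr N / (2 * \<rho>) powr \<delta> * (b j * (2 * r j i) powr \<delta>)"
                unfolding b_def using \<delta>(1) N r[OF i(1)] \<rho> by (intro rescaled_powr_le) auto
              then have "t * (2 ^ j * r j i powr N)
                  \<le> t * (\<rho> powr N / (2 * \<rho>) powr \<delta> * (b j * (2 * r j i) powr \<delta>))"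
                using t by (intro mult_left_mono) auto
              then have "2 ^ j * t * r j i powr N \<le> K * (b j * (2 * r j i) powr \<delta>)"
                by (simp add: K_def mult_ac)
              then show ?thesis
                using True i t K b0[of j] by (simp add: w_def ennreal_mult[symmetric] ennreal_leI)
            qed simp
          qed auto
          finally show ?thesis by simp
        qed
        have "choquet_integral N (ball x \<rho>) (\<lambda>y. e2ennreal \<bar>f y\<bar>) \<le>
            ennreal t * hausdorff_content N (ball x \<rho>) +
            (\<Sum>j. ennreal (2 ^ j * t) *
              hausdorff_content N {z \<in> ball x \<rho>. ennreal (2 ^ j * t) < e2ennreal \<bar>f z\<bar>})"
          by (rule choquet_integral_le_dyadic[OF t])
        also have "\<dots> \<le> ennreal t * ennreal (\<rho> powr N) +
            (\<Sum>j. ennreal K * (\<Sum>i. w j i * indicator (ball x (2 * \<rho>)) (y j i)))"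
          by (intro add_mono mult_left_mono hausdorff_content_ball_le suminf_le row \<rho>) auto
        also have "(\<Sum>j. ennreal K * (\<Sum>i. w j i * indicator (ball x (2 * \<rho>)) (y j i)))
            = ennreal K * emeasure \<nu> (ball x (2 * \<rho>))"
          by (subst \<nu>) auto
        also have "ennreal t * ennreal (\<rho> powr N) + \<dots> \<le>
            ennreal t * ennreal (\<rho> powr N) + ennreal K * ennreal ((2 * \<rho>) powr \<delta>)"
          using small[of "2 * \<rho>"] \<rho> by (intro add_mono mult_left_mono) auto
        also have "\<dots> = ennreal (t * \<rho> powr N + K * (2 * \<rho>) powr \<delta>)"
          using t K by (simp add: ennreal_mult)
        also have "t * \<rho> powr N + K * (2 * \<rho>) powr \<delta> = 2 * t * \<rho> powr N"
          using \<rho> by (simp add: K_def)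
        finally show False using large by simp
      qed
    qed
    also have "\<dots> \<le> ennreal (5 powr \<delta>) * (ennreal (2 powr \<delta>) * (T + ennreal e'))"
      by (intro mult_left_mono total) auto
    also have "\<dots> = ennreal (10 powr \<delta>) * T + ennreal (10 powr \<delta>) * ennreal e'"
    proof -
      have "5 powr \<delta> * 2 powr \<delta> = 10 powr \<delta>"
        by (simp add: powr_mult[symmetric])
      then have "ennreal (5 powr \<delta>) * ennreal (2 powr \<delta>) = ennreal (10 powr \<delta>)"
        by (simp add: ennreal_mult[symmetric])
      then show ?thesis
        by (simp add: mult.assoc[symmetric] distrib_left)
    qed
    also have "ennreal (10 powr \<delta>) * ennreal e' = ennreal e"
      using e by (simp add: e'_def ennreal_mult[symmetric])
    finally show "hausdorff_content \<delta> S \<le> ennreal (10 powr \<delta>) * T + ennreal e" .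
  qed
  then show ?thesis
    by (simp add: S_def T_def E_def b_def N_def)
qed

section \<open>The strong-type estimate\<close>

theorem theorem4p6:
  fixes \<delta> p :: real
  assumes "0 < \<delta>" and "\<delta> \<le> real CARD('n::finite)"
    and "\<delta> / real CARD('n) < p"
  shows "\<exists>c::real. c > 0 \<and> (\<forall>f :: real ^ 'n \<Rightarrow> ereal.
           choquet_integral \<delta> UNIV (\<lambda>x. ennreal_rpow (content_maximal f x) p)
             \<le> ennreal c * choquet_integral \<delta> UNIV (\<lambda>x. ennreal_rpow (e2ennreal \<bar>f x\<bar>) p))"
proof -
  define q where "q = \<delta> / real CARD('n)"
  have q: "0 < q" "q < p" using assms by (auto simp: q_def)
  then have p: "p > 0" by simp
  define \<theta> where "\<theta> = 2 powr (q - p)"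
  have \<theta>: "0 < \<theta>" "\<theta> < 1"
    using q powr_less_mono[of "q - p" 0 2] by (auto simp: \<theta>_def)
  define c where "c = 10 powr \<delta> * (2 powr p * (1 / (1 - \<theta>)))"
  have "choquet_integral \<delta> UNIV (\<lambda>x. ennreal_rpow (content_maximal f x) p)
      \<le> ennreal c * choquet_integral \<delta> UNIV (\<lambda>x. ennreal_rpow (e2ennreal \<bar>f x\<bar>) p)"
    for f :: "real ^ 'n \<Rightarrow> ereal"
  proof -
    define h where "h s = hausdorff_content \<delta> {x \<in> UNIV. ennreal s < ennreal_rpow (e2ennreal \<bar>f x\<bar>) p}" for s
    have h[measurable]: "h \<in> borel_measurable borel"
      unfolding h_def by (intro borel_measurable_antimono_ennreal antimono_superlevel_content)
    \<comment> \<open>With \<open>2 * t = s powr (1 / p)\<close>, the level \<open>2 ^ j * t\<close> of \<open>|f|\<close> is the level \<open>a j * s\<close>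
      of its \<open>p\<close>-th power.\<close>
    define a where "a j = 2 powr (p * (real j - 1))" for j :: nat
    have a: "a j > 0" for j by (simp add: a_def)
    have pointwise: "hausdorff_content \<delta> {x \<in> UNIV. ennreal s < ennreal_rpow (content_maximal f x) p}
        \<le> ennreal (10 powr \<delta>) * (\<Sum>j. ennreal (2 powr (q * real j)) * h (a j * s))"
      if s: "s > 0" for s
    proof -
      define t where "t = s powr (1 / p) / 2"
      have t: "t > 0" using s by (simp add: t_def)
      have "(a j * s) powr (1 / p) = 2 ^ j * t" for j
      proof -
        have "(a j * s) powr (1 / p) = 2 powr (real j - 1) * s powr (1 / p)"
          using s p by (simp add: a_def powr_mult powr_powr)
        also have "\<dots> = 2 ^ j * t"
          by (simp add: t_def powr_diff powr_realpow)
        finally show ?thesis .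
      qed
      then have "h (a j * s) = hausdorff_content \<delta> {x. ennreal (2 ^ j * t) < e2ennreal \<bar>f x\<bar>}" for j
        using s a[of j] p by (simp add: h_def less_ennreal_rpow_iff)
      moreover have "{x \<in> UNIV. ennreal s < ennreal_rpow (content_maximal f x) p}
          = {x. ennreal (2 * t) < content_maximal f x}"
        using s p by (simp add: less_ennreal_rpow_iff t_def)
      ultimately show ?thesis
        using content_maximal_weak_type[OF assms(1,2) t, of f] by (simp add: q_def)
    qed
    have coeff: "2 powr (q * real j) * (1 / a j) = 2 powr p * \<theta> ^ j" for j
      by (simp add: a_def \<theta>_def powr_realpow[symmetric] powr_powr powr_minus_divide[symmetric]
          powr_add[symmetric] algebra_simps)
    have "choquet_integral \<delta> UNIV (\<lambda>x. ennreal_rpow (content_maximal f x) p)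
        \<le> (\<integral>\<^sup>+s\<in>{0<..}. ennreal (10 powr \<delta>) * (\<Sum>j. ennreal (2 powr (q * real j)) * h (a j * s)) \<partial>lborel)"
      unfolding choquet_integral_def
      by (intro nn_integral_mono) (auto simp: indicator_def intro: pointwise[simplified])
    also have "\<dots> = (\<integral>\<^sup>+s. ennreal (10 powr \<delta>) *
        (\<Sum>j. ennreal (2 powr (q * real j)) * (h (a j * s) * indicator {0<..} s)) \<partial>lborel)"
      by (intro nn_integral_cong) (auto simp: indicator_def)
    also have "\<dots> = ennreal (10 powr \<delta>) *
        (\<Sum>j. ennreal (2 powr (q * real j)) * (\<integral>\<^sup>+s\<in>{0<..}. h (a j * s) \<partial>lborel))"
      by (simp add: nn_integral_cmult nn_integral_suminf)
    also have "\<dots> = ennreal (10 powr \<delta>) *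
        (\<Sum>j. ennreal (2 powr p * \<theta> ^ j) * (\<integral>\<^sup>+s\<in>{0<..}. h s \<partial>lborel))"
      by (simp add: nn_integral_scale_Ioi[OF h a] mult.assoc[symmetric] ennreal_mult[symmetric]
          less_imp_le[OF a] coeff[symmetric])
    also have "\<dots> = ennreal (10 powr \<delta>) *
        ((\<Sum>j. ennreal (2 powr p * \<theta> ^ j)) * (\<integral>\<^sup>+s\<in>{0<..}. h s \<partial>lborel))"
      by simp
    also have "(\<Sum>j. ennreal (2 powr p * \<theta> ^ j)) = ennreal (2 powr p * (1 / (1 - \<theta>)))"
      using \<theta> by (intro suminf_ennreal_eq sums_mult geometric_sums) auto
    also have "ennreal (10 powr \<delta>) * (ennreal (2 powr p * (1 / (1 - \<theta>))) * (\<integral>\<^sup>+s\<in>{0<..}. h s \<partial>lborel))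
        = ennreal c * choquet_integral \<delta> UNIV (\<lambda>x. ennreal_rpow (e2ennreal \<bar>f x\<bar>) p)"
      using \<theta> unfolding c_def choquet_integral_def h_def
      by (subst ennreal_mult) (auto simp: mult.assoc)
    finally show ?thesis .
  qed
  moreover have "c > 0" using \<theta> by (simp add: c_def)
  ultimately show ?thesis by blast
qed

end
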